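(* Let $m$ and $n$ be nonnegative integers with $m\le n$. The polynomial $\mathcal{N}^{(m)}_n(1,t)$ is $\gamma$-positive since it satisfies $$\mathcal{N}^{(m)}_n(1,t) = \sum_{k=0}^{\lfloor (n-m)/2\rfloor} \binom{n-m}{2k}\, T_{k,m}\, t^k (1+t)^{n-m-2k}.$$
   Context: The super Catalan numbers are $T_{n,m}=\frac{(2m)!\,(2n)!}{m!\,n!\,(m+n)!}$ for nonnegative integers $n,m$. For nonnegative integers $m\le n$ and $k\le n-m$, the $m$-Narayana numbers are $N^{(m)}_{n,k}=\binom{2m}{m}\binom{n}{m}^{-1}\binom{n}{k}\binom{n}{k+m}$, and the $m$-Narayana polynomial is $\mathcal{N}^{(m)}_n(1,t)=\sum_{k=0}^{n-m}N^{(m)}_{n,k}t^k$. A polynomial $f(t)$ is $\gamma$-positive if it can be written as $f(t)=\sum_{k=0}^{\lfloor d/2\rfloor}\gamma_k t^k(1+t)^{d-2k}$ for some nonnegative integer $d$ with nonnegative real numbers $\gamma_0,\dots,\gamma_{\lfloor d/2\rfloor}$ (here $d=n-m$). *)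

theory Defs
  imports Complex_Main "HOL-Computational_Algebra.Polynomial"
begin

definition super_catalan :: "nat \<Rightarrow> nat \<Rightarrow> real" where
  "super_catalan n m = (fact (2 * m) * fact (2 * n)) / (fact m * fact n * fact (m + n))"

(* Intended for m \<le> n and k \<le> n - m; n - m below is subtraction on nat. *)
definition m_narayana :: "nat \<Rightarrow> nat \<Rightarrow> nat \<Rightarrow> real" where
  "m_narayana m n k =
     real ((2 * m) choose m) * inverse (real (n choose m)) *
     real (n choose k) * real (n choose (k + m))"

(* The univariate polynomial in t obtained by setting the first variable to 1. *)
definition m_narayana_poly :: "nat \<Rightarrow> nat \<Rightarrow> real poly" where
  "m_narayana_poly m n = (\<Sum>k = 0..n - m. monom (m_narayana m n k) k)"

(* [:0, 1:] is the indeterminate t and [:1, 1:] is 1 + t. *)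
definition gamma_positive :: "real poly \<Rightarrow> bool" where
  "gamma_positive f \<longleftrightarrow>
     (\<exists>(d::nat) (\<gamma> :: nat \<Rightarrow> real).
        (\<forall>k \<le> d div 2. 0 \<le> \<gamma> k) \<and>
        f = (\<Sum>k = 0..d div 2. smult (\<gamma> k) ([:0, 1:] ^ k * [:1, 1:] ^ (d - 2 * k))))"

end

theory Submission
  imports Defs
begin

text \<open>
  Both sides are compared coefficientwise. With \<open>d = n - m\<close>, the factorials \<open>(2 * k)!\<close> cancel in
  \<open>(d choose 2 * k) * super_catalan k m * (d - 2 * k choose j - k)\<close>, and what remains is, up to a
  factor independent of \<open>k\<close>, the product \<open>(j choose k) * (n - j choose d - j - k)\<close>. The sum over
  \<open>k\<close> is then the Vandermonde convolution for \<open>n choose d - j\<close>.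
\<close>

lemma coeff_pX_power_mult:
  "coeff ([:0, 1:] ^ k * p) j = (if k \<le> j then coeff (p :: 'a::comm_semiring_1 poly) (j - k) else 0)"
  using coeff_monom_mult[of 1 k p j] by (simp add: monom_altdef)

lemma coeff_one_plus_X_power:
  "coeff ([:1, 1:] ^ e) i = (of_nat (e choose i) :: 'a::comm_semiring_1)"
  by (cases "i \<le> e") (simp_all add: coeff_linear_poly_power coeff_eq_0 degree_linear_power binomial_eq_0)

lemma coeff_m_narayana_poly:
  "coeff (m_narayana_poly m n) j = (if j \<le> n - m then m_narayana m n j else 0)"
  by (simp add: m_narayana_poly_def coeff_sum)

text \<open>The symmetry of \<open>n choose (j + m)\<close> brings out the right-hand side of
  Vandermonde; the prefactor is the one in \<open>super_catalan_term_eq\<close>.\<close>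

lemma m_narayana_eq:
  assumes "m \<le> n" "j \<le> n - m"
  shows "m_narayana m n j =
    fact (2 * m) * fact (n - m) / (fact m * fact j * fact (n - j)) * real (n choose (n - m - j))"
proof -
  have "n choose (n - m - j) = n choose (j + m)"
    using assms binomial_symmetric[of "j + m" n] by (simp add: diff_diff_left add.commute)
  then show ?thesis
    using assms by (simp add: m_narayana_def binomial_fact field_simps)
qed

lemma super_catalan_term_eq:
  assumes "m \<le> n" "k \<le> j" "k \<le> n - m - j" "j \<le> n - m"
  shows "real ((n - m) choose (2 * k)) * super_catalan k m * real ((n - m - 2 * k) choose (j - k)) =
    fact (2 * m) * fact (n - m) / (fact m * fact j * fact (n - j)) *
      (real (j choose k) * real ((n - j) choose (n - m - j - k)))"
proof -
  \<comment> \<open>With the slacks \<open>i\<close> and \<open>r\<close> all truncated differences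
    become sums, so the binomials expand into factorials that cancel.\<close>
  obtain i where j: "j = k + i"
    using assms(2) le_Suc_ex by blast
  obtain r where "n - m - j = k + r"
    using assms(3) le_Suc_ex by blast
  then have n: "n = m + (k + i) + (k + r)"
    using assms j by linarith
  have diffs: "n - m = 2 * k + (i + r)" "n - m - 2 * k = i + r" "j - k = i" "n - j = r + (m + k)"
    "n - m - j - k = r"
    by (simp_all add: n j)
  show ?thesis
    unfolding diffs by (simp add: j super_catalan_def binomial_fact mult_ac)
qed

text \<open>This compares the coefficients of t^j. The guard is needed because for k > j the
  truncated \<open>j - k\<close> is 0 and its binomial would be 1.\<close>

lemma sum_super_catalan_eq_m_narayana:
  assumes "m \<le> n" "j \<le> n - m"
  shows "(\<Sum>k = 0..(n - m) div 2. if k \<le> j then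
      real ((n - m) choose (2 * k)) * super_catalan k m * real ((n - m - 2 * k) choose (j - k)) else 0)
    = m_narayana m n j"
proof -
  define C :: real where "C = fact (2 * m) * fact (n - m) / (fact m * fact j * fact (n - j))"
  define g where "g k = C * (real (j choose k) * real ((n - j) choose (n - m - j - k)))" for k
  have "(\<Sum>k = 0..(n - m) div 2. if k \<le> j then
      real ((n - m) choose (2 * k)) * super_catalan k m * real ((n - m - 2 * k) choose (j - k)) else 0)
    = (\<Sum>k \<le> min j (n - m - j). g k)"
    \<comment> \<open>Put d = n - m. From k \<le> j and k \<le> d - j follows 2k \<le> d, so no
      index is added. A dropped k \<le> j has k > d - j, hence d - 2k < j - k and a zero
      binomial.\<close>
    using assms by (intro sum.mono_neutral_cong_right)
      (auto simp: super_catalan_term_eq C_def g_def binomial_eq_0 simp del: diff_diff_left)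
  also have "\<dots> = (\<Sum>k \<le> n - m - j. g k)"
    \<comment> \<open>The added indices k > j contribute nothing, as \<open>j choose k\<close> is
      0.\<close>
    by (intro sum.mono_neutral_left) (auto simp: g_def binomial_eq_0)
  also have "\<dots> = C * real (n choose (n - m - j))"
    using assms arg_cong[OF vandermonde[of j "n - j" "n - m - j"], of real]
    by (simp add: g_def flip: sum_distrib_left)
  finally show ?thesis
    using assms by (simp add: m_narayana_eq C_def)
qed

theorem proposition9:
  fixes m n :: nat
  assumes "m \<le> n"
  shows "gamma_positive (m_narayana_poly m n) \<and>
    m_narayana_poly m n =
      (\<Sum>k = 0..(n - m) div 2.
         smult (real ((n - m) choose (2 * k)) * super_catalan k m)
           ([:0, 1:] ^ k * [:1, 1:] ^ (n - m - 2 * k)))"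
proof -
  have expansion: "m_narayana_poly m n =
      (\<Sum>k = 0..(n - m) div 2.
         smult (real ((n - m) choose (2 * k)) * super_catalan k m)
           ([:0, 1:] ^ k * [:1, 1:] ^ (n - m - 2 * k)))" (is "_ = ?R")
  proof (rule poly_eqI)
    fix j
    have "coeff ?R j = (\<Sum>k = 0..(n - m) div 2. if k \<le> j then
      real ((n - m) choose (2 * k)) * super_catalan k m * real ((n - m - 2 * k) choose (j - k)) else 0)"
      unfolding coeff_sum coeff_smult coeff_pX_power_mult coeff_one_plus_X_power
      by (intro sum.cong) auto
    also have "\<dots> = coeff (m_narayana_poly m n) j"
    proof (cases "j \<le> n - m")
      case True
      then show ?thesis
        using assms by (simp only: sum_super_catalan_eq_m_narayana coeff_m_narayana_poly if_True)
    next
      case False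
      then show ?thesis
        \<comment> \<open>Here j - k > n - m - 2k, so every binomial vanishes.\<close>
        by (simp add: coeff_m_narayana_poly) (auto intro!: sum.neutral simp: binomial_eq_0)
    qed
    finally show "coeff (m_narayana_poly m n) j = coeff ?R j" ..
  qed
  moreover have "gamma_positive (m_narayana_poly m n)"
    unfolding gamma_positive_def
    \<comment> \<open>The witnesses are read off the expansion; they are nonnegative, since
      \<open>super_catalan\<close> is a quotient of factorials.\<close>
    by (rule exI[of _ "n - m"],
        rule exI[of _ "\<lambda>k. real ((n - m) choose (2 * k)) * super_catalan k m"])
      (use expansion in \<open>simp add: super_catalan_def\<close>)
  ultimately show ?thesis by blast
qed

end
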